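(* Let $q$ be a prime power, $n\ge1$ an integer, and let $f(x),g(x),h(x)\in\mathbf{F}_q[x]$ be monic polynomials of degree less than $n$ such that $f(x)$ and $g(x)$ divide $x^n-1$. If $f(x)\mid g(x)\mid g^\perp(x)\mid f^\perp(x)$, then the quasi-cyclic code $Q_q(f,g,h)\subset\mathbf{F}_q^{2n}$ contains its Euclidean dual.
   Context: $R=\mathbf{F}_q[x]/(x^n-1)$ and $[a(x)]$ is the class of $a(x)$ in $R$. A vector $(a_0,\ldots,a_{n-1})\in\mathbf{F}_q^n$ is identified with $[a_0+a_1x+\cdots+a_{n-1}x^{n-1}]\in R$, and $\mathbf{F}_q^{2n}$ is identified with $R^2$ accordingly (first $n$ coordinates, last $n$ coordinates). $Q_q(f,g,h)$ is the $R$-submodule of $R^2$ generated by $([f(x)],[h(x)f(x)])$ and $(0,[g(x)])$. For a divisor $f(x)$ of $x^n-1$, let $f'(x)$ be defined by $f(x)f'(x)=x^n-1$ and put $f^\perp(x)=x^{\deg f'}f'(1/x)$; similarly for $g^\perp$. The Euclidean dual is taken with respect to the standard inner product on $\mathbf{F}_q^{2n}$. *)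

theory Defs
  imports
    "HOL-Algebra.Chinese_Remainder"
    "HOL-Algebra.Algebraic_Closure_Type"
    "HOL-Computational_Algebra.Polynomial"
    "HOL.Hull"
    "Jordan_Normal_Form.Matrix"
begin

abbreviation Fq_poly_ring :: "'a::field poly ring" where
  "Fq_poly_ring \<equiv> ring_of_type_algebra"

definition xn1_ideal :: "nat \<Rightarrow> 'a::field poly set" where
  "xn1_ideal n = PIdl\<^bsub>Fq_poly_ring\<^esub> (monom 1 n - 1)"

definition cyc_ring :: "nat \<Rightarrow> 'a::field poly set ring" where
  "cyc_ring n = Fq_poly_ring Quot xn1_ideal n"

definition cyc_class :: "nat \<Rightarrow> 'a::field poly \<Rightarrow> 'a poly set" where
  "cyc_class n a = xn1_ideal n +>\<^bsub>Fq_poly_ring\<^esub> a"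

text \<open>
  The record type of modules extends that of rings, so the additive structure of \<open>R\<^sup>2\<close> is taken
  from the direct product ring; the ring multiplication it also carries plays no role.
\<close>

definition cyc_module2 :: "nat \<Rightarrow> ('a::field poly set, 'a poly set \<times> 'a poly set) module" where
  "cyc_module2 n = ring.extend (RDirProd (cyc_ring n) (cyc_ring n))
     (module.fields (\<lambda>r (u, v). (r \<otimes>\<^bsub>cyc_ring n\<^esub> u, r \<otimes>\<^bsub>cyc_ring n\<^esub> v)))"

definition vec_classes :: "nat \<Rightarrow> 'a::field vec \<Rightarrow> 'a poly set \<times> 'a poly set" where
  "vec_classes n v =
     (cyc_class n (\<Sum>i<n. monom (v $ i) i), cyc_class n (\<Sum>i<n. monom (v $ (n + i)) i))"

definition Q_submodule ::
  "nat \<Rightarrow> 'a::field poly \<Rightarrow> 'a poly \<Rightarrow> 'a poly \<Rightarrow> ('a poly set \<times> 'a poly set) set" where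
  "Q_submodule n f g h =
     (\<lambda>N. submodule N (cyc_ring n) (cyc_module2 n)) hull
       {(cyc_class n f, cyc_class n (h * f)), (\<zero>\<^bsub>cyc_ring n\<^esub>, cyc_class n g)}"

definition Q_code :: "nat \<Rightarrow> 'a::field poly \<Rightarrow> 'a poly \<Rightarrow> 'a poly \<Rightarrow> 'a vec set" where
  "Q_code n f g h = {v \<in> carrier_vec (2 * n). vec_classes n v \<in> Q_submodule n f g h}"

definition euclidean_dual :: "nat \<Rightarrow> 'a::field vec set \<Rightarrow> 'a vec set" where
  "euclidean_dual N C = {w \<in> carrier_vec N. \<forall>c\<in>C. c \<bullet> w = 0}"

definition cofactor :: "nat \<Rightarrow> 'a::field poly \<Rightarrow> 'a poly" where
  "cofactor n f = (monom 1 n - 1) div f"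

text \<open>
  \<^const>\<open>reflect_poly\<close> reverses the coefficients: \<open>reflect_poly p\<close> is \<open>x\<^sup>d p(1/x)\<close> with \<open>d = deg p\<close>.
\<close>

definition perp_poly :: "nat \<Rightarrow> 'a::field poly \<Rightarrow> 'a poly" where
  "perp_poly n f = reflect_poly (cofactor n f)"

lemma cofactor_mult: "f dvd monom 1 n - 1 \<Longrightarrow> f * cofactor n f = monom 1 n - 1"
  by (simp add: cofactor_def)

lemma cring_Fq_poly_ring: "cring (Fq_poly_ring :: 'a::field poly ring)"
  by (rule cring_from_type_algebra)

lemma ideal_xn1_ideal: "ideal (xn1_ideal n) (Fq_poly_ring :: 'a::field poly ring)"
  unfolding xn1_ideal_def
  by (rule cring.cgenideal_ideal[OF cring_Fq_poly_ring]) (simp add: ring_of_type_algebra_def)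

lemma cring_cyc_ring: "cring (cyc_ring n :: 'a::field poly set ring)"
  unfolding cyc_ring_def
  by (rule ideal.quotient_is_cring[OF ideal_xn1_ideal cring_Fq_poly_ring])

lemma mem_cyc_class_iff:
  fixes a b :: "'a::field poly"
  shows "b \<in> cyc_class n a \<longleftrightarrow> monom 1 n - 1 dvd b - a"
proof
  assume "b \<in> cyc_class n a"
  then show "monom 1 n - 1 dvd b - a"
    by (auto simp: cyc_class_def a_r_coset_def r_coset_def xn1_ideal_def cgenideal_def ring_of_type_algebra_def)
next
  assume "monom 1 n - 1 dvd b - a"
  then obtain k where "b - a = (monom 1 n - 1) * k" ..
  then have "b = k * (monom 1 n - 1) + a" by (simp add: algebra_simps)
  then show "b \<in> cyc_class n a"
    by (auto simp: cyc_class_def a_r_coset_def r_coset_def xn1_ideal_def cgenideal_def ring_of_type_algebra_def)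
qed

lemma module_cyc_module2:
  "Module.module (cyc_ring n) (cyc_module2 n :: ('a::field poly set, 'a poly set \<times> 'a poly set) module)"
proof -
  let ?R = "cyc_ring n :: 'a poly set ring"
  interpret R: cring ?R by (rule cring_cyc_ring)
  show ?thesis
  proof (rule moduleI)
    show "cring ?R" by (rule cring_cyc_ring)
    show "abelian_group (cyc_module2 n :: ('a poly set, 'a poly set \<times> 'a poly set) module)"
    proof (rule abelian_groupI)
      fix x :: "'a poly set \<times> 'a poly set"
      assume "x \<in> carrier (cyc_module2 n :: ('a poly set, 'a poly set \<times> 'a poly set) module)"
      then show "\<exists>y\<in>carrier (cyc_module2 n :: ('a poly set, 'a poly set \<times> 'a poly set) module).
          y \<oplus>\<^bsub>cyc_module2 n\<^esub> x = \<zero>\<^bsub>cyc_module2 n\<^esub>"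
        by (intro bexI[of _ "(\<ominus>\<^bsub>?R\<^esub> fst x, \<ominus>\<^bsub>?R\<^esub> snd x)"])
           (auto simp: cyc_module2_def RDirProd_def DirProd_def monoid.defs ring.defs module.defs R.l_neg)
    qed (auto simp: cyc_module2_def RDirProd_def DirProd_def monoid.defs ring.defs module.defs
           R.a_ac)
  qed (auto simp: cyc_module2_def RDirProd_def DirProd_def monoid.defs ring.defs module.defs
         R.l_distr R.r_distr R.m_assoc)
qed

end

theory Submission
  imports Defs
begin

text \<open>
  Write M = x^n - 1, and for a word t put T = sum t_i x^i and T* = sum t_i x^(n-i), a
  representative of T(1/x) modulo M.  The inner product of the word of A with t is the constant
  coefficient of A T* mod M, so testing (s,t) in the dual against all shifts of (f, hf) and (0, g)
  gives M | f (S* + h T*) and M | g T*.  Cancelling, f' | S* + h T* and g' | T*; as f | g implies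
  g' | f', also g' | S*.  Reversing coefficients turns this into: g^perp, hence g, divides both S
  and T.  Every pair of multiples of g lies in the code because f | g.
\<close>

lemma degree_xn1:
  assumes "n \<ge> 1"
  shows "degree (monom 1 n - 1 :: 'a::field poly) = n"
proof (rule antisym)
  show "degree (monom 1 n - 1 :: 'a poly) \<le> n"
    by (rule degree_diff_le) (auto simp: degree_monom_le)
  show "n \<le> degree (monom 1 n - 1 :: 'a poly)"
    using assms by (intro le_degree) simp
qed

text \<open>The bound \<open>2 * n\<close> means that subtracting \<open>n\<close> at most once
  reduces the exponent. It covers a residue of degree below \<open>n\<close> times a monomial of
  degree at most \<open>n\<close>.\<close>

lemma monom_mod_xn1:
  assumes "n \<ge> 1" "m < 2 * n"
  shows "(monom c m :: 'a::field poly) mod (monom 1 n - 1) = monom c (m mod n)"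
proof (cases "m < n")
  case True
  then have "degree (monom c m) < degree (monom 1 n - 1 :: 'a poly)"
    by (simp add: degree_xn1[OF assms(1)] le_less_trans[OF degree_monom_le])
  then show ?thesis using True by (simp add: mod_poly_less)
next
  case False
  let ?M = "monom 1 n - 1 :: 'a poly"
  have "monom c m = monom c (m - n) * ?M + monom c (m - n)"
    using False by (simp add: algebra_simps mult_monom)
  then have "monom c m mod ?M = monom c (m - n) mod ?M"
    by (metis mod_mult_self3)
  also have "\<dots> = monom c (m - n)"
    using assms False degree_xn1[OF assms(1), where ?'a = 'a]
    by (intro mod_poly_less) (auto intro!: le_less_trans[OF degree_monom_le])
  also have "m - n = m mod n"
    using assms False by (simp add: mod_if)
  finally show ?thesis .
qed

lemma mod_xn1_as_sum:
  assumes "n \<ge> 1"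
  shows "(\<Sum>k<n. monom (coeff (p mod (monom 1 n - 1)) k) k) = p mod (monom 1 n - 1 :: 'a::field poly)"
proof -
  have "p mod (monom 1 n - 1) = 0 \<or> degree (p mod (monom 1 n - 1)) < n"
    using degree_mod_less[of "monom 1 n - 1 :: 'a poly" p] degree_xn1[OF assms, where ?'a = 'a] assms
    by fastforce
  then have "degree (p mod (monom 1 n - 1)) \<le> n - 1" using assms by auto
  then show ?thesis
    using poly_as_sum_of_monoms'[of "p mod (monom 1 n - 1)" "n - 1"] assms
    by (simp add: lessThan_Suc_atMost[symmetric])
qed

text \<open>The exponent \<open>n - j\<close> stands for \<open>-j\<close> modulo \<open>n\<close>.\<close>

lemma coeff_0_shift_mod_xn1:
  fixes p :: "'a::field poly"
  assumes "j < n"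
  shows "coeff ((p * monom c (n - j)) mod (monom 1 n - 1)) 0 = coeff (p mod (monom 1 n - 1)) j * c"
proof -
  let ?M = "monom 1 n - 1 :: 'a poly"
  let ?a = "coeff (p mod ?M)"
  have n: "n \<ge> 1" using assms by simp
  \<comment> \<open>Only the term of index \<open>j\<close> is moved to a multiple of
    \<open>n\<close>, so it alone reaches the constant coefficient.\<close>
  have ind: "(k + (n - j)) mod n = 0 \<longleftrightarrow> k = j" if "k < n" for k
    using that assms by (auto simp: mod_if)
  have "(p * monom c (n - j)) mod ?M = ((p mod ?M) * monom c (n - j)) mod ?M"
    by (simp add: mod_mult_left_eq)
  also have "(p mod ?M) * monom c (n - j) = (\<Sum>k<n. monom (?a k * c) (k + (n - j)))"
    by (subst mod_xn1_as_sum[OF n, symmetric]) (simp add: sum_distrib_right mult_monom)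
  also have "\<dots> mod ?M = (\<Sum>k<n. monom (?a k * c) (k + (n - j)) mod ?M) mod ?M"
    by (simp add: mod_sum_eq)
  also have "(\<Sum>k<n. monom (?a k * c) (k + (n - j)) mod ?M)
      = (\<Sum>k<n. monom (?a k * c) ((k + (n - j)) mod n))"
    using n assms by (intro sum.cong refl monom_mod_xn1) auto
  also have "\<dots> mod ?M = \<dots>"
    using n degree_xn1[OF n, where ?'a = 'a]
    by (intro mod_poly_less) (auto intro!: degree_sum_less le_less_trans[OF degree_monom_le])
  also have "coeff \<dots> 0 = (\<Sum>k<n. if k = j then ?a k * c else 0)"
    by (auto simp: coeff_sum ind intro!: sum.cong)
  finally show ?thesis using assms by simp
qed

text \<open>Multiplying by x^(n-j) rotates coefficient \<open>j\<close> of the residue into position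
  0, so the hypothesis on shifts kills every coefficient of the residue.\<close>

lemma xn1_dvdI:
  fixes p :: "'a::field poly"
  assumes "n \<ge> 1" and "\<And>i. coeff ((monom 1 i * p) mod (monom 1 n - 1)) 0 = 0"
  shows "monom 1 n - 1 dvd p"
proof -
  have "coeff (p mod (monom 1 n - 1)) j = 0" if "j < n" for j
    using coeff_0_shift_mod_xn1[OF that, of p 1] assms(2)[of "n - j"] by (simp add: mult.commute)
  then have "p mod (monom 1 n - 1) = 0"
    by (subst mod_xn1_as_sum[OF assms(1), symmetric]) simp
  then show ?thesis by auto
qed

text \<open>Index 0 contributes to x^n rather than to 1. Reversing with respect to degree
  \<open>n\<close> then gives sum t_i x^i exactly, with no reduction modulo x^n - 1.\<close>

definition conj_poly :: "nat \<Rightarrow> (nat \<Rightarrow> 'a::field) \<Rightarrow> 'a poly" where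
  "conj_poly n t = (\<Sum>i<n. monom (t i) (n - i))"

lemma coeff_0_mult_conj_poly:
  fixes p :: "'a::field poly"
  shows "coeff ((p * conj_poly n t) mod (monom 1 n - 1)) 0
    = (\<Sum>i<n. coeff (p mod (monom 1 n - 1)) i * t i)"
proof -
  let ?M = "monom 1 n - 1 :: 'a poly"
  have "(\<Sum>i\<in>A. q i) mod ?M = (\<Sum>i\<in>A. q i mod ?M)" for A and q :: "nat \<Rightarrow> 'a poly"
    by (induction A rule: infinite_finite_induct) (auto simp: poly_mod_add_left)
  then show ?thesis
    by (simp add: conj_poly_def sum_distrib_left coeff_sum coeff_0_shift_mod_xn1)
qed

text \<open>With P = \<open>conj_poly n t\<close>, both sides are x^n P(1/x). Since
  \<open>reflect_poly\<close> reverses only up to the actual degree of P, a power of x makes up the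
  difference to \<open>n\<close>.\<close>

lemma reflect_poly_conj_poly:
  "(\<Sum>i<n. monom (t i) i)
    = monom 1 (n - degree (conj_poly n t)) * reflect_poly (conj_poly n t)"
proof (rule poly_eqI)
  fix k
  let ?p = "conj_poly n t"
  \<comment> \<open>Both guards matter: for \<open>m = 0\<close> the index \<open>n\<close> lies
    outside the sum, and for m > n the truncated difference \<open>n - m\<close> would wrongly
    select index 0.\<close>
  have c: "coeff ?p m = (if 1 \<le> m \<and> m \<le> n then t (n - m) else 0)" for m
  proof -
    have "coeff ?p m = (\<Sum>i<n. if i = n - m \<and> 1 \<le> m \<and> m \<le> n then t i else 0)"
      unfolding conj_poly_def coeff_sum by (intro sum.cong) auto
    then show ?thesis by (auto simp: if_distrib)
  qed
  have deg: "degree ?p \<le> n"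
    by (rule degree_le) (simp add: c)
  have "coeff (\<Sum>i<n. monom (t i) i) k = (if k \<le> n then coeff ?p (n - k) else 0)"
    by (auto simp: coeff_sum c)
  also have "\<dots> = coeff (monom 1 (n - degree ?p) * reflect_poly ?p) k"
    using deg by (auto simp: coeff_monom_mult coeff_reflect_poly coeff_eq_0 intro!: arg_cong[of _ _ "coeff ?p"])
  finally show "coeff (\<Sum>i<n. monom (t i) i) k = \<dots>" .
qed

text \<open>Reversal is multiplicative over a field, so it carries divisors to divisors.\<close>

lemma reflect_poly_dvd_of_dvd_conj_poly:
  assumes "d dvd conj_poly n t"
  shows "reflect_poly d dvd (\<Sum>i<n. monom (t i) i)"
  using assms by (auto simp: reflect_poly_conj_poly reflect_poly_mult elim!: dvdE)

lemma cyc_class_eq_iff: "cyc_class n a = cyc_class n b \<longleftrightarrow> monom 1 n - 1 dvd a - b"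
proof
  assume "cyc_class n a = cyc_class n b"
  moreover have "a \<in> cyc_class n a" by (simp add: mem_cyc_class_iff)
  ultimately show "monom 1 n - 1 dvd a - b" by (simp add: mem_cyc_class_iff)
next
  assume d: "monom 1 n - 1 dvd a - b"
  have "monom 1 n - 1 dvd x - a \<longleftrightarrow> monom 1 n - 1 dvd x - b" for x
    using dvd_add_left_iff[OF d, of "x - a"] by simp
  then show "cyc_class n a = cyc_class n b"
    by (auto simp: mem_cyc_class_iff)
qed

lemma cyc_class_carrier: "cyc_class n a \<in> carrier (cyc_ring n)"
  by (auto simp: cyc_class_def cyc_ring_def FactRing_def A_RCOSETS_def' ring_of_type_algebra_def)

lemma cyc_class_mult: "cyc_class n a \<otimes>\<^bsub>cyc_ring n\<^esub> cyc_class n b = cyc_class n (a * b)"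
  using ideal.rcoset_mult_add[OF ideal_xn1_ideal, of a b n]
  by (simp add: cyc_class_def cyc_ring_def FactRing_def ring_of_type_algebra_def)

lemma cyc_class_add: "cyc_class n a \<oplus>\<^bsub>cyc_ring n\<^esub> cyc_class n b = cyc_class n (a + b)"
  using abelian_subgroup.a_rcos_sum[OF abelian_subgroupI3[OF ideal.axioms(1)[OF ideal_xn1_ideal]
        ring.is_abelian_group[OF cring.axioms(1)[OF cring_Fq_poly_ring]]], of a b n]
  by (simp add: cyc_class_def cyc_ring_def FactRing_def ring_of_type_algebra_def)

lemma cyc_class_0: "\<zero>\<^bsub>cyc_ring n\<^esub> = cyc_class n 0"
  by (auto simp: cyc_ring_def FactRing_def mem_cyc_class_iff xn1_ideal_def cgenideal_def
      ring_of_type_algebra_def dvd_def mult.commute)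

text \<open>Every submodule containing the two generators contains their combination with
  coefficients [a] and [b]. This supplies the words that test the dual and later proves membership
  in the code.\<close>

lemma Q_submoduleI:
  "(cyc_class n (a * f), cyc_class n (a * (h * f) + b * g)) \<in> Q_submodule n f g h"
  unfolding Q_submodule_def hull_def
proof (rule InterI, clarify)
  fix N :: "('a poly set \<times> 'a poly set) set"
  assume "submodule N (cyc_ring n) (cyc_module2 n)"
    and "{(cyc_class n f, cyc_class n (h * f)), (\<zero>\<^bsub>cyc_ring n\<^esub>, cyc_class n g)} \<subseteq> N"
  then interpret submodule N "cyc_ring n" "cyc_module2 n"
    by simp
  have gens: "(cyc_class n f, cyc_class n (h * f)) \<in> N" "(cyc_class n 0, cyc_class n g) \<in> N"
    using \<open>_ \<subseteq> N\<close> by (auto simp: cyc_class_0)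
  have smult: "(cyc_class n (p * u), cyc_class n (p * v)) \<in> N"
    if "(cyc_class n u, cyc_class n v) \<in> N" for p u v
    using smult_closed[OF cyc_class_carrier that, of p]
    by (simp add: cyc_module2_def module.defs ring.defs cyc_class_mult)
  have "(cyc_class n (a * f), cyc_class n (a * (h * f)))
      \<oplus>\<^bsub>cyc_module2 n\<^esub> (cyc_class n (b * 0), cyc_class n (b * g)) \<in> N"
    using m_closed[OF smult[OF gens(1)] smult[OF gens(2)]] by simp
  then show "(cyc_class n (a * f), cyc_class n (a * (h * f) + b * g)) \<in> N"
    by (simp add: cyc_module2_def RDirProd_def DirProd_def monoid.defs ring.defs module.defs
        cyc_class_add)
qed

text \<open>A section of \<open>vec_classes\<close>: the reduced representatives of [a] and [b]
  become the two halves of a vector.\<close>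

definition word :: "nat \<Rightarrow> 'a::field poly \<Rightarrow> 'a poly \<Rightarrow> 'a vec" where
  "word n a b = vec (2 * n) (\<lambda>j. if j < n then coeff (a mod (monom 1 n - 1)) j
     else coeff (b mod (monom 1 n - 1)) (j - n))"

lemma word_in_Q_code:
  assumes "n \<ge> 1"
  shows "word n (a * f) (a * (h * f) + b * g) \<in> Q_code n f g h"
proof -
  have "cyc_class n (p mod (monom 1 n - 1)) = cyc_class n p" for p :: "'a poly"
    by (simp add: cyc_class_eq_iff flip: mod_eq_dvd_iff)
  moreover have "(\<Sum>i<n. monom (word n u v $ i) i) = u mod (monom 1 n - 1)"
    and "(\<Sum>i<n. monom (word n u v $ (n + i)) i) = v mod (monom 1 n - 1)" for u v :: "'a poly"
    by (simp_all add: word_def mod_xn1_as_sum[OF assms])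
  ultimately show ?thesis
    using Q_submoduleI[of n a f h b g]
    by (simp add: Q_code_def vec_classes_def) (simp add: word_def)
qed

text \<open>Splitting the index range at \<open>n\<close> leaves two sums to which
  \<open>coeff_0_mult_conj_poly\<close> applies.\<close>

lemma scalar_prod_word:
  fixes w :: "'a::field vec"
  assumes "w \<in> carrier_vec (2 * n)"
  shows "word n a b \<bullet> w = coeff ((a * conj_poly n (\<lambda>i. w $ i)
    + b * conj_poly n (\<lambda>i. w $ (n + i))) mod (monom 1 n - 1)) 0"
proof -
  have "word n a b \<bullet> w = (\<Sum>i<n + n. word n a b $ i * w $ i)"
    using assms by (simp add: scalar_prod_def atLeast0LessThan mult_2)
  also have "\<dots> = (\<Sum>i<n. word n a b $ i * w $ i) + (\<Sum>i<n. word n a b $ (n + i) * w $ (n + i))"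
    using sum.shift_bounds_nat_ivl[of "\<lambda>i. word n a b $ i * w $ i" 0 n n]
      sum.atLeastLessThan_concat[of 0 n "n + n" "\<lambda>i. word n a b $ i * w $ i"]
    by (simp add: atLeast0LessThan add.commute)
  also have "\<dots> = coeff ((a * conj_poly n (\<lambda>i. w $ i)
    + b * conj_poly n (\<lambda>i. w $ (n + i))) mod (monom 1 n - 1)) 0"
    by (simp add: poly_mod_add_left coeff_0_mult_conj_poly word_def)
  finally show ?thesis .
qed

text \<open>Solve (s, t) = a (f, h f) + b (0, g): the first coordinate forces a = s / f, a
  polynomial as f | g | s, and then b = (t - h s) / g.\<close>

lemma Q_codeI:
  fixes w :: "'a::field vec"
  assumes "w \<in> carrier_vec (2 * n)" and "f dvd g"
    and "g dvd (\<Sum>i<n. monom (w $ i) i)" and "g dvd (\<Sum>i<n. monom (w $ (n + i)) i)"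
  shows "w \<in> Q_code n f g h"
proof -
  let ?s = "\<Sum>i<n. monom (w $ i) i" and ?t = "\<Sum>i<n. monom (w $ (n + i)) i"
  obtain a where a: "?s = f * a" using assms by (meson dvdE dvd_trans)
  have "g dvd ?t - h * ?s" using assms by simp
  then obtain b where "?t - h * ?s = g * b" ..
  then have "?t = a * (h * f) + b * g" using a by (simp add: algebra_simps)
  then show ?thesis
    using assms(1) a Q_submoduleI[of n a f h b g]
    by (simp add: Q_code_def vec_classes_def mult.commute)
qed

theorem proposition10:
  fixes n :: nat and f g h :: "'a::{field,finite} poly"
  assumes "n \<ge> 1"
    and "lead_coeff f = 1" and "lead_coeff g = 1" and "lead_coeff h = 1"
    and "degree f < n" and "degree g < n" and "degree h < n"
    and "f dvd monom 1 n - 1" and "g dvd monom 1 n - 1"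
    and "f dvd g" and "g dvd perp_poly n g" and "perp_poly n g dvd perp_poly n f"
  shows "euclidean_dual (2 * n) (Q_code n f g h) \<subseteq> Q_code n f g h"
proof
  fix w assume "w \<in> euclidean_dual (2 * n) (Q_code n f g h)"
  then have w: "w \<in> carrier_vec (2 * n)" and orth: "\<And>c. c \<in> Q_code n f g h \<Longrightarrow> c \<bullet> w = 0"
    by (auto simp: euclidean_dual_def)
  let ?M = "monom 1 n - 1 :: 'a poly"
  define S where "S = conj_poly n (\<lambda>i. w $ i)"
  define T where "T = conj_poly n (\<lambda>i. w $ (n + i))"
  have nz: "f \<noteq> 0" "g \<noteq> 0" using assms(2,3) by auto
  have pair: "coeff ((a * f * S + (a * (h * f) + b * g) * T) mod ?M) 0 = 0" for a b
    using orth[OF word_in_Q_code[OF assms(1), of a f h b g]] scalar_prod_word[OF w]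
    by (simp add: S_def T_def)
  \<comment> \<open>The shifts of the first generator: a = x^i and b = 0 in
    \<open>pair\<close>.\<close>
  have "?M dvd f * (S + h * T)"
    by (rule xn1_dvdI[OF assms(1)]) (use pair[of "monom 1 _" 0] in \<open>simp add: algebra_simps\<close>)
  then have f': "cofactor n f dvd S + h * T"
    using nz by (simp flip: cofactor_mult[OF assms(8)])
  have "?M dvd g * T"
    by (rule xn1_dvdI[OF assms(1)]) (use pair[of 0 "monom 1 _"] in \<open>simp add: algebra_simps\<close>)
  then have T: "cofactor n g dvd T"
    using nz by (simp flip: cofactor_mult[OF assms(9)])
  obtain k where "g = f * k" using assms(10) ..
  \<comment> \<open>Both sides equal x^n - 1; cancelling f leaves f' = k g'.\<close>
  then have "f * cofactor n f = f * (k * cofactor n g)"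
    using cofactor_mult[OF assms(8)] cofactor_mult[OF assms(9)] by (simp add: mult.assoc)
  then have "cofactor n g dvd cofactor n f" using nz by simp
  then have S: "cofactor n g dvd S"
    using f' T by (meson dvd_add_left_iff dvd_mult dvd_trans)
  \<comment> \<open>Reversing g' gives g^perp, which therefore divides the polynomials of both
    halves of \<open>w\<close>; so does g, since g | g^perp.\<close>
  show "w \<in> Q_code n f g h"
    using reflect_poly_dvd_of_dvd_conj_poly[OF S[unfolded S_def]]
      reflect_poly_dvd_of_dvd_conj_poly[OF T[unfolded T_def]] assms(11)
    by (intro Q_codeI[OF w assms(10)]) (auto simp: perp_poly_def intro: dvd_trans)
qed

end
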